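(* Assume (A1) and (A2) as stated in the context. For every $\theta\in\Theta$, let $e_r^u=u_h-u_r$, $e_r^\psi=\psi_h-\psi_r$, $e_r^\eta(\theta)=\eta_y(u_h(\theta))-\eta_y(u_r(\theta))$, and $e_r^\Delta(\theta)=\eta_y(u_h(\theta))-\eta_y^\Delta(\theta)$, where $\eta_y^\Delta(\theta)=\eta_y(u_r(\theta))+A(u_r(\theta),\psi_r(\theta);\theta)-F(\psi_r(\theta);\theta)$. Then $$\|\nabla_\theta e_r^\eta(\theta)\|_1\le (C_y+C_{\mathcal O}C_u(\theta))\,\|\nabla_\theta e_r^u(\theta)\|_{V^d}+C_{\mathcal O}\|\nabla_\theta u_r(\theta)\|_{V^d}\|e_r^u(\theta)\|_V$$ and $$\begin{aligned}\|\nabla_\theta e_r^\Delta(\theta)\|_1\le{}&\gamma(\theta)\|\nabla_\theta e_r^u(\theta)\|_{V^d}\|e_r^\psi(\theta)\|_V+\gamma(\theta)\|\nabla_\theta e_r^\psi(\theta)\|_{V^d}\|e_r^u(\theta)\|_V\\&+\sum_{j=1}^d\rho_j(\theta)\,\|e_r^u(\theta)\|_V\|e_r^\psi(\theta)\|_V+C_{\mathcal O}\|e_r^u(\theta)\|_V\|\nabla_\theta e_r^u(\theta)\|_{V^d}.\end{aligned}$$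
   Context: Setting. $V$ is a real Hilbert space with dual $V'$; $\Theta\subset\mathbb R^d$ is the parameter set; for each $\theta\in\Theta$, $A(\cdot,\cdot;\theta):V\times V\to\mathbb R$ is bilinear and $F(\cdot;\theta):V\to\mathbb R$ is linear. $\mathcal O=(o_1,\dots,o_s)$ with $o_i\in V'$, $\|\mathcal O\|_{V'}:=(\sum_i\|o_i\|_{V'}^2)^{1/2}$; $y\in\mathbb R^s$; $\Gamma\in\mathbb R^{s\times s}$ is symmetric positive definite. The potential is $\eta_y(u)=\frac12(y-\mathcal O(u))^T\Gamma^{-1}(y-\mathcal O(u))$ for $u\in V$, with derivative $\nabla_u\eta_y|_u(w)=-(y-\mathcal O(u))^T\Gamma^{-1}\mathcal O(w)$. Assumptions. (A1) For every $\theta\in\Theta$ there are $\alpha(\theta)>0$, $\gamma(\theta)>0$ with $\alpha(\theta)\|w\|_V^2\le A(w,w;\theta)$ and $A(w,v;\theta)\le\gamma(\theta)\|w\|_V\|v\|_V$ for all $w,v\in V$, and $\|F(\cdot;\theta)\|_{V'}<\infty$. (A2) $A(\cdot,\cdot;\theta)$ and $F(\cdot;\theta)$ are continuously differentiable in $\theta$ at every $\theta\in\Theta$ (as maps into the Banach spaces of bounded bilinear forms on $V$ and $V'$: continuous with continuous partial derivatives), and for each $j=1,\dots,d$ there is $0<\rho_j(\theta)<\infty$ with $\partial_{\theta_j}A(w,v;\theta)\le\rho_j(\theta)\|w\|_V\|v\|_V$ for all $w,v\in V$, and $\|\partial_{\theta_j}F(\cdot;\theta)\|_{V'}<\infty$.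 Here $\partial_{\theta_j}A(w,v;\theta)$ differentiates only the explicit dependence on $\theta$, with $w,v$ fixed. All partial derivatives at $\theta$ are limits of difference quotients over $\varepsilon\to0$ with $\theta+\varepsilon e_j\in\Theta$ ($e_j$ the $j$-th unit vector; $\Theta$ is such that arbitrarily small nonzero such $\varepsilon$ exist for all $\theta\in\Theta$ and $j$). Discrete problems. $V_h\subset V$ is a finite-dimensional subspace; $V_r,W_r\subset V_h$ are subspaces (all independent of $\theta$). For each $\theta$: $u_h\in V_h$ solves $A(u_h,v;\theta)=F(v;\theta)$ for all $v\in V_h$; $\psi_h\in V_h$ solves $A(w,\psi_h;\theta)=-\nabla_u\eta_y|_{u_h}(w)$ for all $w\in V_h$; $u_r\in V_r$ solves $A(u_r,v;\theta)=F(v;\theta)$ for all $v\in V_r$; $\psi_r\in W_r$ solves $A(w,\psi_r;\theta)=-\nabla_u\eta_y|_{u_r}(w)$ for all $w\in W_r$. Notation. $\nabla_\theta$ is the total gradient in $\theta$; $\|g\|_1=\sum_j|g_j|$ on $\mathbb R^d$; for a $V$-valued function $v(\theta)$, $\|\nabla_\theta v(\theta)\|_{V^d}:=\sum_{j=1}^d\|\partial_{\theta_j}v(\theta)\|_V$. $C_y:=\|\Gamma^{-1}\|_2\|\mathcal O\|_{V'}\|y\|_2$, $C_{\mathcal O}:=\|\Gamma^{-1}\|_2\|\mathcal O\|_{V'}^2$ (spectral and Euclidean norms), $C_u(\theta):=\|F(\cdot;\theta)\|_{V'}/\alpha(\theta)$. *)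

theory Defs
  imports "HOL-Analysis.Analysis"
begin

text \<open>Partial derivatives relative to \<open>\<Theta>\<close>: \<open>D\<close> is the limit of
  \<open>(f (\<theta> + \<epsilon> *\<^sub>R axis j 1) - f \<theta>) /\<^sub>R \<epsilon>\<close> as \<open>\<epsilon> \<rightarrow> 0\<close> with \<open>\<theta> + \<epsilon> *\<^sub>R axis j 1 \<in> \<Theta>\<close>
  (see \<open>has_partial_deriv_iff_quotient\<close> below).\<close>

definition slice :: "(real^'d) set \<Rightarrow> 'd \<Rightarrow> real^'d \<Rightarrow> real set" where
  "slice \<Theta> j \<theta> = {\<epsilon>. \<theta> + \<epsilon> *\<^sub>R axis j 1 \<in> \<Theta>}"

definition has_partial_deriv ::
  "(real^'d) set \<Rightarrow> 'd \<Rightarrow> (real^'d \<Rightarrow> 'b::real_normed_vector) \<Rightarrow> real^'d \<Rightarrow> 'b \<Rightarrow> bool" where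
  "has_partial_deriv \<Theta> j f \<theta> D \<longleftrightarrow>
     ((\<lambda>\<epsilon>. f (\<theta> + \<epsilon> *\<^sub>R axis j 1)) has_vector_derivative D) (at 0 within slice \<Theta> j \<theta>)"

definition partial_differentiable ::
  "(real^'d) set \<Rightarrow> 'd \<Rightarrow> (real^'d \<Rightarrow> 'b::real_normed_vector) \<Rightarrow> real^'d \<Rightarrow> bool" where
  "partial_differentiable \<Theta> j f \<theta> \<longleftrightarrow> (\<exists>D. has_partial_deriv \<Theta> j f \<theta> D)"

text \<open>The value is meaningful only where \<open>partial_differentiable\<close> holds and \<open>0\<close> is a limit
  point of the slice, so that the derivative is unique.\<close>

definition partial_deriv ::
  "(real^'d) set \<Rightarrow> 'd \<Rightarrow> (real^'d \<Rightarrow> 'b::real_normed_vector) \<Rightarrow> real^'d \<Rightarrow> 'b" where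
  "partial_deriv \<Theta> j f \<theta> =
     vector_derivative (\<lambda>\<epsilon>. f (\<theta> + \<epsilon> *\<^sub>R axis j 1)) (at 0 within slice \<Theta> j \<theta>)"

lemma has_partial_deriv_iff_quotient:
  "has_partial_deriv \<Theta> j f \<theta> D \<longleftrightarrow>
     ((\<lambda>\<epsilon>. (f (\<theta> + \<epsilon> *\<^sub>R axis j 1) - f \<theta>) /\<^sub>R \<epsilon>) \<longlongrightarrow> D) (at 0 within slice \<Theta> j \<theta>)"
proof -
  have *: "norm ((f (\<theta> + \<epsilon> *\<^sub>R axis j 1) - f \<theta>) /\<^sub>R \<epsilon> - D) =
      norm (f (\<theta> + \<epsilon> *\<^sub>R axis j 1) - f \<theta> - \<epsilon> *\<^sub>R D) / \<bar>\<epsilon>\<bar>" if "\<epsilon> \<noteq> 0" for \<epsilon>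
  proof -
    have "(f (\<theta> + \<epsilon> *\<^sub>R axis j 1) - f \<theta>) /\<^sub>R \<epsilon> - D =
        (f (\<theta> + \<epsilon> *\<^sub>R axis j 1) - f \<theta> - \<epsilon> *\<^sub>R D) /\<^sub>R \<epsilon>"
      using that by (simp add: scaleR_diff_right)
    then show ?thesis by (simp add: divide_inverse mult.commute)
  qed
  have "((\<lambda>\<epsilon>. (f (\<theta> + \<epsilon> *\<^sub>R axis j 1) - f \<theta>) /\<^sub>R \<epsilon>) \<longlongrightarrow> D) (at 0 within slice \<Theta> j \<theta>) \<longleftrightarrow>
     ((\<lambda>\<epsilon>. norm ((f (\<theta> + \<epsilon> *\<^sub>R axis j 1) - f \<theta>) /\<^sub>R \<epsilon> - D)) \<longlongrightarrow> 0) (at 0 within slice \<Theta> j \<theta>)"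
    unfolding tendsto_norm_zero_iff LIM_zero_iff ..
  also have "\<dots> \<longleftrightarrow> ((\<lambda>\<epsilon>. norm (f (\<theta> + \<epsilon> *\<^sub>R axis j 1) - f \<theta> - \<epsilon> *\<^sub>R D) / \<bar>\<epsilon>\<bar>) \<longlongrightarrow> 0)
      (at 0 within slice \<Theta> j \<theta>)"
    by (rule filterlim_cong[OF refl refl]) (use * in \<open>simp add: eventually_at_filter\<close>)
  also have "\<dots> \<longleftrightarrow> has_partial_deriv \<Theta> j f \<theta> D"
    unfolding has_partial_deriv_def has_vector_derivative_def has_derivative_iff_norm
    by (simp add: bounded_linear_scaleR_left)
  finally show ?thesis by simp
qed

text \<open>The sum of the norms of the partial derivatives: this is \<open>\<parallel>\<nabla>\<^sub>\<theta> g(\<theta>)\<parallel>\<^sub>1\<close> for real-valued \<open>g\<close>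
  and \<open>\<parallel>\<nabla>\<^sub>\<theta> v(\<theta>)\<parallel>\<close> in \<open>V\<^sup>d\<close> for \<open>V\<close>-valued \<open>v\<close>.\<close>

definition grad_norm ::
  "(real^'d) set \<Rightarrow> (real^'d \<Rightarrow> 'b::real_normed_vector) \<Rightarrow> real^'d \<Rightarrow> real" where
  "grad_norm \<Theta> f \<theta> = (\<Sum>j\<in>UNIV. norm (partial_deriv \<Theta> j f \<theta>))"

definition continuously_differentiable_on ::
  "(real^'d) set \<Rightarrow> (real^'d \<Rightarrow> 'b::real_normed_vector) \<Rightarrow> bool" where
  "continuously_differentiable_on \<Theta> f \<longleftrightarrow>
     continuous_on \<Theta> f \<and>
     (\<forall>j. (\<forall>\<theta>\<in>\<Theta>. partial_differentiable \<Theta> j f \<theta>) \<and> continuous_on \<Theta> (partial_deriv \<Theta> j f))"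

text \<open>A bounded bilinear form as an element of the Banach space
  \<open>'v \<Rightarrow>\<^sub>L 'v \<Rightarrow>\<^sub>L real\<close>, whose norm is the usual norm of bilinear forms;
  meaningful only for bounded \<open>B\<close>.\<close>

definition blin_form :: "('v::real_normed_vector \<Rightarrow> 'v \<Rightarrow> real) \<Rightarrow> 'v \<Rightarrow>\<^sub>L 'v \<Rightarrow>\<^sub>L real" where
  "blin_form B = Blinfun (\<lambda>w. Blinfun (B w))"

lemma blin_form_apply:
  assumes "bilinear B" and bd: "\<And>w v. B w v \<le> C * norm w * norm v"
  shows "blinfun_apply (blinfun_apply (blin_form B) w) v = B w v"
proof -
  have "\<bar>B w v\<bar> \<le> norm w * norm v * C" for w v
  proof -
    have "- B w v = B (- w) v" using assms(1) by (simp add: bilinear_lneg)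
    then show ?thesis using bd[of w v] bd[of "- w" v] by (simp add: abs_le_iff mult.commute mult.left_commute)
  qed
  moreover have "B (a + a') b = B a b + B a' b" "B a (b + b') = B a b + B a b'"
    "B (r *\<^sub>R a) b = r *\<^sub>R B a b" "B a (r *\<^sub>R b) = r *\<^sub>R B a b" for a a' b b' r
    using assms(1)
    by (simp_all add: bilinear_ladd bilinear_radd bilinear_lmul bilinear_rmul)
  ultimately interpret bounded_bilinear B
    by unfold_locales auto
  interpret flip: bounded_bilinear "\<lambda>v w. B w v"
    by (rule flip)
  have "Blinfun (B w) = flip.prod_left w" for w
    by (rule blinfun_eqI)
      (simp add: bounded_linear_Blinfun_apply bounded_linear_right flip.prod_left.rep_eq)
  then show ?thesis
    by (simp add: blin_form_def bounded_linear_Blinfun_apply flip.bounded_linear_prod_left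
        flip.prod_left.rep_eq)
qed

definition pos_def_matrix :: "real^'s^'s \<Rightarrow> bool" where
  "pos_def_matrix \<Gamma> \<longleftrightarrow> transpose \<Gamma> = \<Gamma> \<and> (\<forall>x. x \<noteq> 0 \<longrightarrow> x \<bullet> (\<Gamma> *v x) > 0)"

definition spectral_norm :: "real^'s^'s \<Rightarrow> real" where
  "spectral_norm M = onorm ((*v) M)"

definition observe :: "('s \<Rightarrow> 'v::real_normed_vector \<Rightarrow>\<^sub>L real) \<Rightarrow> 'v \<Rightarrow> real^'s" where
  "observe obs u = (\<chi> i. blinfun_apply (obs i) u)"

definition obs_norm :: "('s::finite \<Rightarrow> 'v::real_normed_vector \<Rightarrow>\<^sub>L real) \<Rightarrow> real" where
  "obs_norm obs = sqrt (\<Sum>i\<in>UNIV. (norm (obs i))\<^sup>2)"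

definition potential ::
  "real^'s^'s \<Rightarrow> ('s \<Rightarrow> 'v::real_normed_vector \<Rightarrow>\<^sub>L real) \<Rightarrow> real^'s \<Rightarrow> 'v \<Rightarrow> real" where
  "potential \<Gamma> obs y u =
     1/2 * ((y - observe obs u) \<bullet> (matrix_inv \<Gamma> *v (y - observe obs u)))"

definition potential_deriv ::
  "real^'s^'s \<Rightarrow> ('s \<Rightarrow> 'v::real_normed_vector \<Rightarrow>\<^sub>L real) \<Rightarrow> real^'s \<Rightarrow> 'v \<Rightarrow> 'v \<Rightarrow> real" where
  "potential_deriv \<Gamma> obs y u w = - ((y - observe obs u) \<bullet> (matrix_inv \<Gamma> *v observe obs w))"

lemma pos_def_matrix_inv:
  assumes "pos_def_matrix \<Gamma>"
  shows "\<Gamma> ** matrix_inv \<Gamma> = mat 1" "matrix_inv \<Gamma> ** \<Gamma> = mat 1"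
proof -
  have "x = 0" if "\<Gamma> *v x = 0" for x
    using assms that unfolding pos_def_matrix_def by fastforce
  then have "\<exists>B. B ** \<Gamma> = mat 1"
    by (simp add: matrix_left_invertible_ker)
  then have "\<exists>B. \<Gamma> ** B = mat 1 \<and> B ** \<Gamma> = mat 1"
    using matrix_left_right_inverse by blast
  then have "\<Gamma> ** matrix_inv \<Gamma> = mat 1 \<and> matrix_inv \<Gamma> ** \<Gamma> = mat 1"
    unfolding matrix_inv_def by (rule someI_ex)
  then show "\<Gamma> ** matrix_inv \<Gamma> = mat 1" "matrix_inv \<Gamma> ** \<Gamma> = mat 1"
    by auto
qed

lemma pos_def_matrix_inv_sym:
  assumes "pos_def_matrix \<Gamma>"
  shows "transpose (matrix_inv \<Gamma>) = matrix_inv \<Gamma>"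
proof -
  let ?M = "matrix_inv \<Gamma>"
  have "transpose ?M ** \<Gamma> = transpose (\<Gamma> ** ?M)"
    using assms by (simp add: matrix_transpose_mul pos_def_matrix_def)
  then have 1: "transpose ?M ** \<Gamma> = mat 1"
    by (simp add: pos_def_matrix_inv[OF assms] transpose_mat)
  have "transpose ?M = transpose ?M ** (\<Gamma> ** ?M)"
    by (simp add: pos_def_matrix_inv[OF assms])
  also have "\<dots> = (transpose ?M ** \<Gamma>) ** ?M"
    by (simp add: matrix_mul_assoc)
  finally show ?thesis
    by (simp add: 1)
qed

lemma potential_has_derivative:
  fixes \<Gamma> :: "real^'s^'s"
  assumes "pos_def_matrix \<Gamma>"
  shows "(potential \<Gamma> obs y has_derivative potential_deriv \<Gamma> obs y u) (at u)"
proof -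
  have "observe obs = (\<lambda>u. \<Sum>i\<in>UNIV. blinfun_apply (obs i) u *\<^sub>R axis i 1)"
    by (rule ext) (simp add: vec_eq_iff observe_def axis_def if_distrib[of "(*) _"] cong: if_cong)
  then have ob: "bounded_linear (observe obs)"
    by (simp add: bounded_linear_sum bounded_linear_scaleR_const blinfun.bounded_linear_right)
  have M: "bounded_linear ((*v) (matrix_inv \<Gamma>))"
    by (rule matrix_vector_mul_bounded_linear)
  have d1: "((\<lambda>u. y - observe obs u) has_derivative (\<lambda>w. - observe obs w)) (at u)"
    using has_derivative_diff[OF has_derivative_const bounded_linear_imp_has_derivative[OF ob]]
    by simp
  have sym: "a \<bullet> (matrix_inv \<Gamma> *v b) = b \<bullet> (matrix_inv \<Gamma> *v a)" for a b
  proof -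
    have "a \<bullet> (matrix_inv \<Gamma> *v b) = (transpose (matrix_inv \<Gamma>) *v a) \<bullet> b"
      by (simp add: transpose_matrix_vector dot_lmul_matrix)
    then show ?thesis
      by (simp add: pos_def_matrix_inv_sym[OF assms] inner_commute)
  qed
  have d2: "((\<lambda>u. matrix_inv \<Gamma> *v (y - observe obs u)) has_derivative
      (\<lambda>w. matrix_inv \<Gamma> *v (- observe obs w))) (at u)"
    by (rule bounded_linear.has_derivative[OF M d1])
  have "(potential \<Gamma> obs y has_derivative
      (\<lambda>w. 1/2 * ((y - observe obs u) \<bullet> (matrix_inv \<Gamma> *v (- observe obs w))
        + (- observe obs w) \<bullet> (matrix_inv \<Gamma> *v (y - observe obs u))))) (at u)"
    unfolding potential_def[abs_def]
    by (rule has_derivative_mult_right[OF has_derivative_inner[OF d1 d2]])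
  moreover have "1/2 * ((y - observe obs u) \<bullet> (matrix_inv \<Gamma> *v (- observe obs w))
        + (- observe obs w) \<bullet> (matrix_inv \<Gamma> *v (y - observe obs u)))
      = potential_deriv \<Gamma> obs y u w" for w
    using sym[of "- observe obs w" "y - observe obs u"]
    by (simp add: potential_deriv_def linear_neg[OF bounded_linear.linear[OF M]])
  ultimately show ?thesis
    by simp
qed

definition corrected_potential ::
  "('v::real_normed_vector \<Rightarrow> 'v \<Rightarrow> real^'d \<Rightarrow> real) \<Rightarrow> ('v \<Rightarrow> real^'d \<Rightarrow> real) \<Rightarrow>
   real^'s^'s \<Rightarrow> ('s \<Rightarrow> 'v \<Rightarrow>\<^sub>L real) \<Rightarrow> real^'s \<Rightarrow>
   (real^'d \<Rightarrow> 'v) \<Rightarrow> (real^'d \<Rightarrow> 'v) \<Rightarrow> real^'d \<Rightarrow> real" where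
  "corrected_potential A F \<Gamma> obs y u\<^sub>r \<psi>\<^sub>r \<theta> =
     potential \<Gamma> obs y (u\<^sub>r \<theta>) + A (u\<^sub>r \<theta>) (\<psi>\<^sub>r \<theta>) \<theta> - F (\<psi>\<^sub>r \<theta>) \<theta>"

end

(* Since the reduced spaces lie in V_h, testing the primal problem with psi_r and the dual problem
   with e_u, together with the exact second-order expansion of the quadratic potential at u_h, gives
     e_Delta = - A(e_u, e_psi) - 1/2 O(e_u)^T Gamma^-1 O(e_u)   on all of Theta.
   Differentiating this by the product rule yields the second bound term by term; the first bound
   splits the derivative of e_eta into the gradient at u_h applied to the derivative of e_u and the
   difference of the two gradients applied to the derivative of u_r. *)
theory Submission
  imports Defs
begin

section \<open>Calculus of partial derivatives relative to \<Theta>\<close>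

lemma has_partial_deriv_tendsto:
  assumes "has_partial_deriv \<Theta> j f \<theta> D"
  shows "((\<lambda>\<epsilon>. f (\<theta> + \<epsilon> *\<^sub>R axis j 1)) \<longlongrightarrow> f \<theta>) (at 0 within slice \<Theta> j \<theta>)"
  using has_vector_derivative_continuous[OF assms[unfolded has_partial_deriv_def]]
  by (simp add: continuous_within)

lemma partial_deriv_eq:
  assumes "0 islimpt slice \<Theta> j \<theta>" and "has_partial_deriv \<Theta> j f \<theta> D"
  shows "partial_deriv \<Theta> j f \<theta> = D"
  unfolding partial_deriv_def using assms
  by (intro vector_derivative_within)
    (simp_all add: has_partial_deriv_def trivial_limit_within)

text \<open>The difference quotients sample only points of \<Theta>, so agreement there suffices;
  \<open>\<theta> \<in> \<Theta>\<close> covers the increment 0. This allows differentiating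
  identities that come from the discrete equations and hence hold on \<Theta> only.\<close>

lemma has_partial_deriv_transform:
  assumes "has_partial_deriv \<Theta> j f \<theta> D" and "\<theta> \<in> \<Theta>" and "\<And>t. t \<in> \<Theta> \<Longrightarrow> g t = f t"
  shows "has_partial_deriv \<Theta> j g \<theta> D"
  unfolding has_partial_deriv_def
  by (rule has_vector_derivative_transform[OF _ _ assms(1)[unfolded has_partial_deriv_def]])
    (use assms(2,3) in \<open>auto simp: slice_def\<close>)

lemma has_partial_deriv_diff:
  assumes "has_partial_deriv \<Theta> j f \<theta> D" and "has_partial_deriv \<Theta> j g \<theta> E"
  shows "has_partial_deriv \<Theta> j (\<lambda>t. f t - g t) \<theta> (D - E)"
  using assms unfolding has_partial_deriv_def by (rule has_vector_derivative_diff)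

lemma has_partial_deriv_compose:
  assumes "has_partial_deriv \<Theta> j f \<theta> D" and "(g has_derivative g') (at (f \<theta>))"
  shows "has_partial_deriv \<Theta> j (\<lambda>t. g (f t)) \<theta> (g' D)"
proof -
  have "((\<lambda>\<epsilon>. g (f (\<theta> + \<epsilon> *\<^sub>R axis j 1))) has_derivative (\<lambda>h. g' (h *\<^sub>R D)))
      (at 0 within slice \<Theta> j \<theta>)"
    by (rule has_derivative_compose[where g = g])
      (use assms in \<open>simp_all add: has_partial_deriv_def has_vector_derivative_def\<close>)
  then show ?thesis
    using linear_scale[OF has_derivative_linear[OF assms(2)]]
    by (simp add: has_partial_deriv_def has_vector_derivative_def)
qed

lemma (in bounded_linear) has_partial_deriv:
  assumes "has_partial_deriv \<Theta> j g \<theta> D"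
  shows "has_partial_deriv \<Theta> j (\<lambda>t. f (g t)) \<theta> (f D)"
  using assms bounded_linear_imp_has_derivative[OF bounded_linear_axioms]
  by (rule has_partial_deriv_compose)

lemma (in bounded_bilinear) has_partial_deriv:
  assumes "has_partial_deriv \<Theta> j f \<theta> D" and "has_partial_deriv \<Theta> j g \<theta> E"
  shows "has_partial_deriv \<Theta> j (\<lambda>t. prod (f t) (g t)) \<theta> (prod (f \<theta>) E + prod D (g \<theta>))"
  using has_vector_derivative[OF assms[unfolded has_partial_deriv_def]]
  by (simp add: has_partial_deriv_def)

section \<open>Differentiability of Galerkin solutions in the parameter\<close>

text \<open>Since \<open>g w \<le> norm g * norm w\<close>, one factor \<open>norm w\<close>
  cancels. This is the stability estimate behind both the differentiability proof and the bound
  \<open>C\<^sub>u\<close> on the discrete solution.\<close>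

lemma coercive_norm_le:
  fixes g :: "'v::real_normed_vector \<Rightarrow>\<^sub>L real"
  assumes "\<alpha> * (norm w)\<^sup>2 \<le> g w"
  shows "\<alpha> * norm w \<le> norm g"
proof (cases "w = 0")
  case False
  have "\<alpha> * norm w * norm w \<le> norm g * norm w"
    using assms norm_blinfun[of g w] by (simp add: power2_eq_square)
  then show ?thesis
    using False by (simp add: mult_le_cancel_right)
qed simp

text \<open>Coercivity at \<open>\<theta>\<close> makes the difference quotients of the solution Cauchy, so completeness
  yields the derivative without solving the differentiated equation. The map \<open>B\<close> turns the form into
  the operator, so that the adjoint problem is covered as well.\<close>

lemma galerkin_partial_differentiable:
  fixes B :: "'f::real_normed_vector \<Rightarrow> 'v::{real_normed_vector, complete_space} \<Rightarrow> 'v \<Rightarrow>\<^sub>L real"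
    and a :: "real^'d \<Rightarrow> 'f" and f :: "real^'d \<Rightarrow> 'v \<Rightarrow>\<^sub>L real"
  assumes B: "bounded_bilinear B" and S: "subspace S" and "\<theta> \<in> \<Theta>" and lim: "0 islimpt slice \<Theta> j \<theta>"
    and a: "has_partial_deriv \<Theta> j a \<theta> a'" and f: "has_partial_deriv \<Theta> j f \<theta> f'"
    and "\<alpha> > 0" and coercive: "\<And>w. w \<in> S \<Longrightarrow> \<alpha> * (norm w)\<^sup>2 \<le> B (a \<theta>) w w"
    and u: "\<And>t. t \<in> \<Theta> \<Longrightarrow> u t \<in> S"
    and eq: "\<And>t v. t \<in> \<Theta> \<Longrightarrow> v \<in> S \<Longrightarrow> B (a t) (u t) v = f t v"
  shows "partial_differentiable \<Theta> j u \<theta>"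
proof -
  interpret B: bounded_bilinear B by (rule B)
  let ?F = "at 0 within slice \<Theta> j \<theta>"
  define s where "s \<epsilon> = \<theta> + \<epsilon> *\<^sub>R axis j 1" for \<epsilon> :: real
  have s: "s \<epsilon> \<in> \<Theta>" if "\<epsilon> \<in> slice \<Theta> j \<theta>" for \<epsilon>
    using that by (simp add: s_def slice_def)
  have inF: "eventually (\<lambda>\<epsilon>. \<epsilon> \<in> slice \<Theta> j \<theta>) ?F"
    by (simp add: eventually_at_filter)
  \<comment> \<open>Stability on \<open>S\<close>: the equation is tested with \<open>v = w\<close>,
    so \<open>g\<close> has to match the form on \<open>S\<close> only, while its norm is the dual
    norm of the whole space.\<close>
  have bound: "\<alpha> * norm w \<le> norm g" if "w \<in> S" "\<And>v. v \<in> S \<Longrightarrow> B (a \<theta>) w v = g v"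
    for w and g :: "'v \<Rightarrow>\<^sub>L real"
    using that coercive[of w] by (intro coercive_norm_le) auto
  \<comment> \<open>The form is frozen at \<theta>; its variation acts on \<open>u t\<close> and
    moves into the load.\<close>
  have diff_eq: "B (a \<theta>) (u t - u \<theta>) v = (f t - f \<theta> - B (a t - a \<theta>) (u t)) v"
    if "t \<in> \<Theta>" "v \<in> S" for t v
    using eq[OF that] eq[OF \<open>\<theta> \<in> \<Theta>\<close> that(2)]
    by (simp add: B.diff_left B.diff_right blinfun.diff_left)
  have a_lim: "((\<lambda>\<epsilon>. a (s \<epsilon>)) \<longlongrightarrow> a \<theta>) ?F" and f_lim: "((\<lambda>\<epsilon>. f (s \<epsilon>)) \<longlongrightarrow> f \<theta>) ?F"
    unfolding s_def using a f by (auto intro: has_partial_deriv_tendsto)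
  obtain K where "K > 0" and K: "\<And>x y. norm (B x y) \<le> norm x * norm y * K"
    using B.pos_bounded by blast
  have u_lim: "((\<lambda>\<epsilon>. u (s \<epsilon>)) \<longlongrightarrow> u \<theta>) ?F"
  proof -
    \<comment> \<open>The load in \<open>diff_eq\<close> contains \<open>u (s \<epsilon>)\<close>
      itself, through a factor of size \<open>da\<close>. Once \<open>da\<close> is below
      \<open>\<alpha> / 2\<close>, the part multiplying the increment of \<open>u\<close> is
      absorbed by half of the coercivity. What remains, divided by the other half, is
      \<open>R\<close>.\<close>
    define da where "da \<epsilon> = norm (a (s \<epsilon>) - a \<theta>) * K" for \<epsilon>
    define R where "R \<epsilon> = (norm (f (s \<epsilon>) - f \<theta>) + da \<epsilon> * norm (u \<theta>)) / (\<alpha> / 2)" for \<epsilon>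
    have "(da \<longlongrightarrow> norm (a \<theta> - a \<theta>) * K) ?F"
      unfolding da_def by (intro tendsto_intros a_lim)
    then have da: "(da \<longlongrightarrow> 0) ?F"
      by simp
    have "(R \<longlongrightarrow> (norm (f \<theta> - f \<theta>) + 0 * norm (u \<theta>)) / (\<alpha> / 2)) ?F"
      unfolding R_def using \<open>\<alpha> > 0\<close> by (intro tendsto_intros f_lim da) simp
    then have R: "(R \<longlongrightarrow> 0) ?F"
      by simp
    have small: "eventually (\<lambda>\<epsilon>. da \<epsilon> < \<alpha> / 2) ?F"
      using order_tendstoD(2)[OF da, of "\<alpha> / 2"] \<open>\<alpha> > 0\<close> by simp
    have "eventually (\<lambda>\<epsilon>. norm (u (s \<epsilon>) - u \<theta>) \<le> R \<epsilon>) ?F"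
      using inF small
    proof eventually_elim
      case (elim \<epsilon>)
      let ?w = "u (s \<epsilon>) - u \<theta>"
      have "0 \<le> da \<epsilon>"
        using \<open>K > 0\<close> by (simp add: da_def)
      have "\<alpha> * norm ?w \<le> norm (f (s \<epsilon>) - f \<theta> - B (a (s \<epsilon>) - a \<theta>) (u (s \<epsilon>)))"
        using s[OF elim(1)] \<open>\<theta> \<in> \<Theta>\<close> by (intro bound diff_eq subspace_diff[OF S] u)
      also have "\<dots> \<le> norm (f (s \<epsilon>) - f \<theta>) + da \<epsilon> * norm (u (s \<epsilon>))"
        using norm_triangle_ineq4[of "f (s \<epsilon>) - f \<theta>" "B (a (s \<epsilon>) - a \<theta>) (u (s \<epsilon>))"]
          K[of "a (s \<epsilon>) - a \<theta>" "u (s \<epsilon>)"]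
        by (simp add: da_def mult_ac)
      also have "\<dots> \<le> norm (f (s \<epsilon>) - f \<theta>) + da \<epsilon> * (norm (u \<theta>) + norm ?w)"
        using \<open>0 \<le> da \<epsilon>\<close> norm_triangle_ineq[of "u \<theta>" ?w] by (intro add_left_mono mult_left_mono) auto
      also have "\<dots> \<le> norm (f (s \<epsilon>) - f \<theta>) + da \<epsilon> * norm (u \<theta>) + \<alpha> / 2 * norm ?w"
        using mult_right_mono[OF less_imp_le[OF elim(2)], of "norm ?w"]
        by (simp add: distrib_left)
      finally have "\<alpha> / 2 * norm ?w \<le> norm (f (s \<epsilon>) - f \<theta>) + da \<epsilon> * norm (u \<theta>)"
        by simp
      then show ?case
        using \<open>\<alpha> > 0\<close> by (simp add: R_def field_simps)
    qed
    then have "((\<lambda>\<epsilon>. u (s \<epsilon>) - u \<theta>) \<longlongrightarrow> 0) ?F"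
      using R by (rule Lim_null_comparison)
    then show ?thesis
      by (simp add: LIM_zero_iff)
  qed
  \<comment> \<open>The quotient \<open>q \<epsilon>\<close> solves a Galerkin problem with the form
    frozen at \<theta> and load \<open>g \<epsilon>\<close>. The loads converge by the
    differentiability of \<open>a\<close> and \<open>f\<close> and the continuity of
    \<open>u\<close> just shown.\<close>
  define q where "q \<epsilon> = (u (s \<epsilon>) - u \<theta>) /\<^sub>R \<epsilon>" for \<epsilon>
  define g where "g \<epsilon> = (f (s \<epsilon>) - f \<theta>) /\<^sub>R \<epsilon> - B ((a (s \<epsilon>) - a \<theta>) /\<^sub>R \<epsilon>) (u (s \<epsilon>))" for \<epsilon>
  have g_lim: "(g \<longlongrightarrow> f' - B a' (u \<theta>)) ?F"
    unfolding g_def using a f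
    by (intro tendsto_diff B.tendsto u_lim) (simp_all add: has_partial_deriv_iff_quotient s_def)
  have qS: "q \<epsilon> \<in> S" if "\<epsilon> \<in> slice \<Theta> j \<theta>" for \<epsilon>
    unfolding q_def using s[OF that] \<open>\<theta> \<in> \<Theta>\<close>
    by (intro subspace_scale[OF S] subspace_diff[OF S] u)
  \<comment> \<open>The slice contains 0 as well; there the inverse of 0 is 0 and both sides
    vanish.\<close>
  have q_eq: "B (a \<theta>) (q \<epsilon>) v = g \<epsilon> v" if "\<epsilon> \<in> slice \<Theta> j \<theta>" "v \<in> S" for \<epsilon> v
    using diff_eq[OF s[OF that(1)] that(2)]
    by (simp add: q_def g_def B.scaleR_right B.scaleR_left blinfun.diff_left blinfun.scaleR_left
        right_diff_distrib)
  \<comment> \<open>The form does not vary with \<open>\<epsilon>\<close>, so two such equations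
    subtract and \<open>bound\<close> applies: the quotients inherit the Cauchy property of their
    loads.\<close>
  have q_diff: "\<alpha> * dist (q \<epsilon>) (q \<delta>) \<le> dist (g \<epsilon>) (g \<delta>)"
    if "\<epsilon> \<in> slice \<Theta> j \<theta>" "\<delta> \<in> slice \<Theta> j \<theta>" for \<epsilon> \<delta>
    unfolding dist_norm using that
    by (intro bound subspace_diff[OF S] qS)
      (simp_all add: B.diff_right blinfun.diff_left q_eq)
  have "cauchy_filter (filtermap q ?F)"
    unfolding cauchy_filter_metric_filtermap
  proof (intro allI impI)
    fix e :: real
    assume "e > 0"
    \<comment> \<open>The radius \<open>\<alpha> * e / 2\<close> puts two loads within
      \<open>\<alpha> * e\<close> of each other, hence two quotients within
      \<open>e\<close>.\<close>
    define P where "P \<epsilon> \<longleftrightarrow> \<epsilon> \<in> slice \<Theta> j \<theta> \<and> dist (g \<epsilon>) (f' - B a' (u \<theta>)) < \<alpha> * e / 2" for \<epsilon>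
    have "eventually P ?F"
      unfolding P_def using \<open>\<alpha> > 0\<close> \<open>e > 0\<close>
      by (intro eventually_conj inF tendstoD[OF g_lim]) simp
    moreover have "dist (q \<epsilon>) (q \<delta>) < e" if "P \<epsilon>" "P \<delta>" for \<epsilon> \<delta>
    proof -
      have "dist (g \<epsilon>) (g \<delta>) < \<alpha> * e"
        by (rule dist_triangle_half_l[where y = "f' - B a' (u \<theta>)"]) (use that in \<open>simp_all add: P_def\<close>)
      then have "\<alpha> * dist (q \<epsilon>) (q \<delta>) < \<alpha> * e"
        using q_diff[of \<epsilon> \<delta>] that by (simp add: P_def)
      then show ?thesis
        using \<open>\<alpha> > 0\<close> by simp
    qed
    ultimately show "\<exists>P. eventually P ?F \<and> (\<forall>x y. P x \<and> P y \<longrightarrow> dist (q x) (q y) < e)"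
      by blast
  qed
  \<comment> \<open>The limit is taken in the complete ambient space; \<open>lim\<close> guarantees
    that the filter is proper.\<close>
  then have "\<exists>D. filtermap q ?F \<le> nhds D"
    by (rule cauchy_filter_complete_converges[where A = UNIV])
      (use lim in \<open>simp_all add: complete_UNIV filtermap_bot_iff trivial_limit_within\<close>)
  then obtain D where "(q \<longlongrightarrow> D) ?F"
    by (auto simp: filterlim_def)
  then have "has_partial_deriv \<Theta> j u \<theta> D"
    by (simp add: has_partial_deriv_iff_quotient q_def[abs_def] s_def)
  then show ?thesis
    by (auto simp: partial_differentiable_def)
qed

section \<open>Estimates and expansions for the quadratic potential\<close>

lemma norm_observe_le: "norm (observe obs u) \<le> obs_norm obs * norm u"
proof -
  have "(norm (observe obs u))\<^sup>2 = (\<Sum>i\<in>UNIV. (obs i u)\<^sup>2)"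
    by (simp add: norm_vec_def L2_set_def observe_def sum_nonneg)
  also have "\<dots> \<le> (\<Sum>i\<in>UNIV. (norm (obs i) * norm u)\<^sup>2)"
    by (intro sum_mono) (metis norm_blinfun norm_ge_zero power_mono power2_abs real_norm_def)
  also have "\<dots> = (obs_norm obs * norm u)\<^sup>2"
    by (simp add: obs_norm_def power_mult_distrib sum_distrib_right sum_nonneg)
  finally show ?thesis
    by (rule power2_le_imp_le) (simp add: obs_norm_def sum_nonneg)
qed

lemma abs_inner_matrix_le: "\<bar>x \<bullet> (M *v y)\<bar> \<le> spectral_norm M * norm x * norm y"
proof -
  have "\<bar>x \<bullet> (M *v y)\<bar> \<le> norm x * norm (M *v y)"
    by (rule Cauchy_Schwarz_ineq2)
  also have "\<dots> \<le> norm x * (spectral_norm M * norm y)"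
    unfolding spectral_norm_def
    by (intro mult_left_mono onorm matrix_vector_mul_bounded_linear) simp
  finally show ?thesis
    by (simp add: mult_ac)
qed

lemma spectral_norm_nonneg: "spectral_norm M \<ge> 0"
  unfolding spectral_norm_def by (rule onorm_pos_le[OF matrix_vector_mul_bounded_linear])

lemma obs_norm_nonneg: "obs_norm obs \<ge> 0"
  by (simp add: obs_norm_def sum_nonneg)

lemma observe_diff: "observe obs (u - v) = observe obs u - observe obs v"
  by (simp add: observe_def vec_eq_iff blinfun.diff_right)

lemma abs_observe_inner_le:
  "\<bar>observe obs u \<bullet> (M *v observe obs w)\<bar> \<le> spectral_norm M * (obs_norm obs)\<^sup>2 * norm u * norm w"
proof -
  have "\<bar>observe obs u \<bullet> (M *v observe obs w)\<bar>
      \<le> spectral_norm M * norm (observe obs u) * norm (observe obs w)"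
    by (rule abs_inner_matrix_le)
  also have "\<dots> \<le> spectral_norm M * (obs_norm obs * norm u) * (obs_norm obs * norm w)"
    by (intro mult_mono mult_left_mono norm_observe_le)
      (simp_all add: spectral_norm_nonneg obs_norm_nonneg)
  finally show ?thesis
    by (simp add: power2_eq_square mult_ac)
qed

text \<open>Splitting the residual \<open>y - observe obs u\<close> produces the two constants: the
  data part gives \<open>C\<^sub>y\<close>, the observed state gives \<open>C\<^sub>O\<close> times
  \<open>norm u\<close>. For \<open>y = 0\<close> only the second survives, which is how the last
  term of the second bound arises.\<close>

lemma abs_potential_deriv_le:
  "\<bar>potential_deriv \<Gamma> obs y u w\<bar>
    \<le> (spectral_norm (matrix_inv \<Gamma>) * obs_norm obs * norm y
       + spectral_norm (matrix_inv \<Gamma>) * (obs_norm obs)\<^sup>2 * norm u) * norm w"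
proof -
  let ?M = "matrix_inv \<Gamma>"
  have "\<bar>y \<bullet> (?M *v observe obs w)\<bar> \<le> spectral_norm ?M * norm y * norm (observe obs w)"
    by (rule abs_inner_matrix_le)
  also have "\<dots> \<le> spectral_norm ?M * norm y * (obs_norm obs * norm w)"
    by (intro mult_left_mono norm_observe_le) (simp add: spectral_norm_nonneg)
  finally show ?thesis
    using abs_observe_inner_le[of obs u ?M w]
    by (simp add: potential_deriv_def inner_diff_left algebra_simps)
qed

text \<open>The derivative is affine in the base point, so the data \<open>y\<close> cancel and the
  difference is controlled by \<open>C\<^sub>O\<close> alone.\<close>

lemma potential_deriv_diff:
  "potential_deriv \<Gamma> obs y u w - potential_deriv \<Gamma> obs y v w
    = observe obs (u - v) \<bullet> (matrix_inv \<Gamma> *v observe obs w)"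
  by (simp add: potential_deriv_def observe_diff inner_diff_left)

lemma potential_deriv_diff_right:
  assumes "pos_def_matrix \<Gamma>"
  shows "potential_deriv \<Gamma> obs y u (v - w) = potential_deriv \<Gamma> obs y u v - potential_deriv \<Gamma> obs y u w"
  by (rule linear_diff[OF has_derivative_linear[OF potential_has_derivative[OF assms]]])

text \<open>With vanishing data \<open>y = 0\<close> the potential is the pure quadratic term.\<close>

lemma potential_diff:
  assumes "pos_def_matrix \<Gamma>"
  shows "potential \<Gamma> obs y u - potential \<Gamma> obs y v
    = potential_deriv \<Gamma> obs y u (u - v) - potential \<Gamma> obs 0 (u - v)"
proof -
  let ?M = "matrix_inv \<Gamma>"
  \<comment> \<open>Symmetry of the inverse merges the mixed terms of the two quadratics.\<close>
  have sym: "a \<bullet> (?M *v b) = b \<bullet> (?M *v a)" for a b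
    by (metis dot_lmul_matrix inner_commute pos_def_matrix_inv_sym[OF assms] transpose_matrix_vector)
  show ?thesis
    using sym[of y "observe obs v"] sym[of y "observe obs u"] sym[of "observe obs u" "observe obs v"]
    by (simp add: potential_def potential_deriv_def observe_diff inner_diff_left inner_diff_right
        matrix_vector_mult_diff_distrib algebra_simps)
qed

lemma potential_partial_deriv:
  assumes "pos_def_matrix \<Gamma>" and "has_partial_deriv \<Theta> j u \<theta> D"
  shows "has_partial_deriv \<Theta> j (\<lambda>t. potential \<Gamma> obs y (u t)) \<theta> (potential_deriv \<Gamma> obs y (u \<theta>) D)"
  by (rule has_partial_deriv_compose[OF assms(2) potential_has_derivative[OF assms(1)]])

section \<open>The adjoint problem as a Galerkin problem\<close>

text \<open>The adjoint load depends on the parameter only through the state, and it is affine in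
  the state as an element of the dual space. A state with a partial derivative thus yields a
  dual-valued load with one, as \<open>galerkin_partial_differentiable\<close> requires.\<close>

lemma partial_deriv_dual_load:
  assumes "has_partial_deriv \<Theta> j u \<theta> D"
  shows "\<exists>f f'. has_partial_deriv \<Theta> j f \<theta> f' \<and>
    (\<forall>t w. blinfun_apply (f t) w = - potential_deriv \<Gamma> obs y (u t) w)"
proof -
  let ?M = "matrix_inv \<Gamma>"
  have obs: "bounded_linear (observe obs)"
    by (rule bounded_linear_intro[where K = "obs_norm obs"])
      (simp_all add: observe_def vec_eq_iff blinfun.add_right blinfun.scaleR_right
        norm_observe_le[unfolded observe_def] mult.commute)
  then have "bounded_linear (\<lambda>w. ?M *v observe obs w)"
    by (rule bounded_linear_compose[OF matrix_vector_mul_bounded_linear])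
  then have "bounded_bilinear (\<lambda>x w. x \<bullet> (?M *v observe obs w))"
    by (rule bounded_bilinear.comp[OF bounded_bilinear_inner bounded_linear_ident])
  \<comment> \<open>The flipped order makes \<open>G.prod_left x\<close> the functional that takes
    the test vector \<open>w\<close> and pairs its observation with \<open>x\<close>.\<close>
  then interpret G: bounded_bilinear "\<lambda>w x. x \<bullet> (?M *v observe obs w)"
    by (rule bounded_bilinear.flip)
  let ?f = "\<lambda>t. G.prod_left (y - observe obs (u t))"
  have "has_partial_deriv \<Theta> j (\<lambda>t. y - observe obs (u t)) \<theta> (0 - observe obs D)"
    by (intro has_partial_deriv_diff bounded_linear.has_partial_deriv[OF obs] assms)
      (simp add: has_partial_deriv_def)
  then have "has_partial_deriv \<Theta> j ?f \<theta> (G.prod_left (0 - observe obs D))"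
    by (rule bounded_linear.has_partial_deriv[OF G.bounded_linear_prod_left])
  moreover have "?f t w = - potential_deriv \<Gamma> obs y (u t) w" for t w
    by (simp add: potential_deriv_def)
  ultimately show ?thesis
    by blast
qed

text \<open>The value at \<open>M\<close> and \<open>v\<close> is the functional taking
  \<open>w\<close> to \<open>M w v\<close>: the unknown sits in the second slot and the test vector
  in the first, as in the adjoint problem.\<close>

lemma bounded_bilinear_blinfun_flip:
  "bounded_bilinear (\<lambda>(M::'v::real_normed_vector \<Rightarrow>\<^sub>L 'v \<Rightarrow>\<^sub>L real) v. blinfun.prod_left v o\<^sub>L M)"
  by (rule bounded_bilinear.flip[OF bounded_bilinear.comp1[OF bounded_bilinear_blinfun_compose
          blinfun.bounded_linear_prod_left]])

section \<open>The gradient bounds\<close>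

text \<open>Differentiability belongs to the conclusion because \<open>grad_norm\<close> is built on
  \<open>partial_deriv\<close>, whose value has meaning only where the derivative exists.\<close>

theorem lemma5p5:
  fixes \<Theta> :: "(real^'d) set"
    and A :: "'v::{real_inner, complete_space} \<Rightarrow> 'v \<Rightarrow> real^'d \<Rightarrow> real"
    and F :: "'v \<Rightarrow> real^'d \<Rightarrow> real"
    and \<Gamma> :: "real^'s^'s"
    and obs :: "'s \<Rightarrow> 'v \<Rightarrow>\<^sub>L real"
    and y :: "real^'s"
    and \<alpha> \<gamma> :: "real^'d \<Rightarrow> real"
    and \<rho> :: "'d \<Rightarrow> real^'d \<Rightarrow> real"
    and V\<^sub>h V\<^sub>r W\<^sub>r :: "'v set"
    and u\<^sub>h u\<^sub>r \<psi>\<^sub>h \<psi>\<^sub>r :: "real^'d \<Rightarrow> 'v"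
  assumes slices: "\<And>\<theta> j. \<theta> \<in> \<Theta> \<Longrightarrow> 0 islimpt slice \<Theta> j \<theta>"
    and A_bilinear: "\<And>\<theta>. \<theta> \<in> \<Theta> \<Longrightarrow> bilinear (\<lambda>w v. A w v \<theta>)"
    and F_linear: "\<And>\<theta>. \<theta> \<in> \<Theta> \<Longrightarrow> linear (\<lambda>v. F v \<theta>)"
    and \<Gamma>_spd: "pos_def_matrix \<Gamma>"
    and A1_pos: "\<And>\<theta>. \<theta> \<in> \<Theta> \<Longrightarrow> \<alpha> \<theta> > 0 \<and> \<gamma> \<theta> > 0"
    and A1_coercive: "\<And>\<theta> w. \<theta> \<in> \<Theta> \<Longrightarrow> \<alpha> \<theta> * (norm w)\<^sup>2 \<le> A w w \<theta>"
    and A1_bounded: "\<And>\<theta> w v. \<theta> \<in> \<Theta> \<Longrightarrow> A w v \<theta> \<le> \<gamma> \<theta> * norm w * norm v"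
    and A1_F: "\<And>\<theta>. \<theta> \<in> \<Theta> \<Longrightarrow> bounded_linear (\<lambda>v. F v \<theta>)"
    and A2_A: "continuously_differentiable_on \<Theta> (\<lambda>\<theta>. blin_form (\<lambda>w v. A w v \<theta>))"
    and A2_F: "continuously_differentiable_on \<Theta> (\<lambda>\<theta>. Blinfun (\<lambda>v. F v \<theta>))"
    and A2_rho: "\<And>\<theta> j. \<theta> \<in> \<Theta> \<Longrightarrow> \<rho> j \<theta> > 0"
    and A2_dA: "\<And>\<theta> j w v. \<theta> \<in> \<Theta> \<Longrightarrow> partial_deriv \<Theta> j (A w v) \<theta> \<le> \<rho> j \<theta> * norm w * norm v"
    and A2_dF: "\<And>\<theta> j. \<theta> \<in> \<Theta> \<Longrightarrow> bounded_linear (\<lambda>v. partial_deriv \<Theta> j (F v) \<theta>)"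
    and Vh: "subspace V\<^sub>h" "\<exists>B. finite B \<and> V\<^sub>h = span B"
    and Vr: "subspace V\<^sub>r" "V\<^sub>r \<subseteq> V\<^sub>h"
    and Wr: "subspace W\<^sub>r" "W\<^sub>r \<subseteq> V\<^sub>h"
    and uh: "\<And>\<theta>. \<theta> \<in> \<Theta> \<Longrightarrow> u\<^sub>h \<theta> \<in> V\<^sub>h \<and> (\<forall>v\<in>V\<^sub>h. A (u\<^sub>h \<theta>) v \<theta> = F v \<theta>)"
    and \<psi>h: "\<And>\<theta>. \<theta> \<in> \<Theta> \<Longrightarrow>
      \<psi>\<^sub>h \<theta> \<in> V\<^sub>h \<and> (\<forall>w\<in>V\<^sub>h. A w (\<psi>\<^sub>h \<theta>) \<theta> = - potential_deriv \<Gamma> obs y (u\<^sub>h \<theta>) w)"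
    and ur: "\<And>\<theta>. \<theta> \<in> \<Theta> \<Longrightarrow> u\<^sub>r \<theta> \<in> V\<^sub>r \<and> (\<forall>v\<in>V\<^sub>r. A (u\<^sub>r \<theta>) v \<theta> = F v \<theta>)"
    and \<psi>r: "\<And>\<theta>. \<theta> \<in> \<Theta> \<Longrightarrow>
      \<psi>\<^sub>r \<theta> \<in> W\<^sub>r \<and> (\<forall>w\<in>W\<^sub>r. A w (\<psi>\<^sub>r \<theta>) \<theta> = - potential_deriv \<Gamma> obs y (u\<^sub>r \<theta>) w)"
  shows "\<forall>\<theta>\<in>\<Theta>.
    let C\<^sub>y = spectral_norm (matrix_inv \<Gamma>) * obs_norm obs * norm y;
        C\<^sub>O = spectral_norm (matrix_inv \<Gamma>) * (obs_norm obs)\<^sup>2;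
        C\<^sub>u = onorm (\<lambda>v. F v \<theta>) / \<alpha> \<theta>;
        e\<^sub>u = (\<lambda>t. u\<^sub>h t - u\<^sub>r t);
        e\<^sub>\<psi> = (\<lambda>t. \<psi>\<^sub>h t - \<psi>\<^sub>r t);
        e\<^sub>\<eta> = (\<lambda>t. potential \<Gamma> obs y (u\<^sub>h t) - potential \<Gamma> obs y (u\<^sub>r t));
        e\<^sub>\<Delta> = (\<lambda>t. potential \<Gamma> obs y (u\<^sub>h t) - corrected_potential A F \<Gamma> obs y u\<^sub>r \<psi>\<^sub>r t)
    in (\<forall>j. partial_differentiable \<Theta> j u\<^sub>r \<theta> \<and> partial_differentiable \<Theta> j e\<^sub>u \<theta> \<and>
            partial_differentiable \<Theta> j e\<^sub>\<psi> \<theta> \<and> partial_differentiable \<Theta> j e\<^sub>\<eta> \<theta> \<and>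
            partial_differentiable \<Theta> j e\<^sub>\<Delta> \<theta>) \<and>
       grad_norm \<Theta> e\<^sub>\<eta> \<theta> \<le>
         (C\<^sub>y + C\<^sub>O * C\<^sub>u) * grad_norm \<Theta> e\<^sub>u \<theta> + C\<^sub>O * grad_norm \<Theta> u\<^sub>r \<theta> * norm (e\<^sub>u \<theta>) \<and>
       grad_norm \<Theta> e\<^sub>\<Delta> \<theta> \<le>
         \<gamma> \<theta> * grad_norm \<Theta> e\<^sub>u \<theta> * norm (e\<^sub>\<psi> \<theta>) + \<gamma> \<theta> * grad_norm \<Theta> e\<^sub>\<psi> \<theta> * norm (e\<^sub>u \<theta>)
         + (\<Sum>j\<in>UNIV. \<rho> j \<theta> * norm (e\<^sub>u \<theta>) * norm (e\<^sub>\<psi> \<theta>))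
         + C\<^sub>O * norm (e\<^sub>u \<theta>) * grad_norm \<Theta> e\<^sub>u \<theta>"
proof -
  let ?M = "matrix_inv \<Gamma>"
  define C\<^sub>y where "C\<^sub>y = spectral_norm ?M * obs_norm obs * norm y"
  define C\<^sub>O where "C\<^sub>O = spectral_norm ?M * (obs_norm obs)\<^sup>2"
  \<comment> \<open>Form and load as elements of the Banach spaces in which (A2) differentiates
    them; \<open>a\<close> then enters product rules like any other factor.\<close>
  define a where "a t = blin_form (\<lambda>w v. A w v t)" for t
  define f where "f t = Blinfun (\<lambda>v. F v t)" for t
  define e\<^sub>u where "e\<^sub>u t = u\<^sub>h t - u\<^sub>r t" for t
  define e\<^sub>\<psi> where "e\<^sub>\<psi> t = \<psi>\<^sub>h t - \<psi>\<^sub>r t" for t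
  define e\<^sub>\<eta> where "e\<^sub>\<eta> t = potential \<Gamma> obs y (u\<^sub>h t) - potential \<Gamma> obs y (u\<^sub>r t)" for t
  define e\<^sub>\<Delta> where
    "e\<^sub>\<Delta> t = potential \<Gamma> obs y (u\<^sub>h t) - corrected_potential A F \<Gamma> obs y u\<^sub>r \<psi>\<^sub>r t" for t
  have a: "a t w v = A w v t" if "t \<in> \<Theta>" for t w v
    unfolding a_def using A_bilinear[OF that] A1_bounded[OF that] by (rule blin_form_apply)
  have f: "f t v = F v t" if "t \<in> \<Theta>" for t v
    unfolding f_def using A1_F[OF that] by (simp add: bounded_linear_Blinfun_apply)
  have e\<^sub>\<Delta>_eq: "e\<^sub>\<Delta> t = - a t (e\<^sub>u t) (e\<^sub>\<psi> t) - potential \<Gamma> obs 0 (e\<^sub>u t)" if "t \<in> \<Theta>" for t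
  proof -
    have "e\<^sub>u t \<in> V\<^sub>h"
      using uh[OF that] ur[OF that] Vr Vh(1) by (auto simp: e\<^sub>u_def intro: subspace_diff)
    then have "potential_deriv \<Gamma> obs y (u\<^sub>h t) (e\<^sub>u t) = - a t (e\<^sub>u t) (\<psi>\<^sub>h t)"
      using \<psi>h[OF that] by (simp add: a[OF that])
    moreover have "F (\<psi>\<^sub>r t) t = a t (u\<^sub>h t) (\<psi>\<^sub>r t)"
      using uh[OF that] \<psi>r[OF that] Wr by (auto simp: a[OF that])
    ultimately show ?thesis
      using potential_diff[OF \<Gamma>_spd, of obs y "u\<^sub>h t" "u\<^sub>r t"]
      by (simp add: e\<^sub>\<Delta>_def corrected_potential_def a[OF that, symmetric] e\<^sub>u_def e\<^sub>\<psi>_def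
          blinfun.diff_left blinfun.diff_right)
  qed
  have main: "(\<forall>j. partial_differentiable \<Theta> j u\<^sub>r \<theta> \<and> partial_differentiable \<Theta> j e\<^sub>u \<theta> \<and>
            partial_differentiable \<Theta> j e\<^sub>\<psi> \<theta> \<and> partial_differentiable \<Theta> j e\<^sub>\<eta> \<theta> \<and>
            partial_differentiable \<Theta> j e\<^sub>\<Delta> \<theta>) \<and>
       grad_norm \<Theta> e\<^sub>\<eta> \<theta> \<le>
         (C\<^sub>y + C\<^sub>O * (onorm (\<lambda>v. F v \<theta>) / \<alpha> \<theta>)) * grad_norm \<Theta> e\<^sub>u \<theta>
         + C\<^sub>O * grad_norm \<Theta> u\<^sub>r \<theta> * norm (e\<^sub>u \<theta>) \<and>
       grad_norm \<Theta> e\<^sub>\<Delta> \<theta> \<le>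
         \<gamma> \<theta> * grad_norm \<Theta> e\<^sub>u \<theta> * norm (e\<^sub>\<psi> \<theta>) + \<gamma> \<theta> * grad_norm \<Theta> e\<^sub>\<psi> \<theta> * norm (e\<^sub>u \<theta>)
         + (\<Sum>j\<in>UNIV. \<rho> j \<theta> * norm (e\<^sub>u \<theta>) * norm (e\<^sub>\<psi> \<theta>))
         + C\<^sub>O * norm (e\<^sub>u \<theta>) * grad_norm \<Theta> e\<^sub>u \<theta>" if \<theta>: "\<theta> \<in> \<Theta>" for \<theta>
  proof -
    let ?C\<^sub>u = "onorm (\<lambda>v. F v \<theta>) / \<alpha> \<theta>"
    have \<alpha>: "\<alpha> \<theta> > 0" and \<gamma>: "\<gamma> \<theta> > 0"
      using A1_pos[OF \<theta>] by auto
    have coercive: "\<alpha> \<theta> * (norm w)\<^sup>2 \<le> a \<theta> w w" for w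
      using A1_coercive[OF \<theta>] by (simp add: a[OF \<theta>])
    \<comment> \<open>The one-sided bound in (A1) becomes two-sided by replacing \<open>w\<close>
      with \<open>- w\<close>.\<close>
    have a_abs: "\<bar>a \<theta> w v\<bar> \<le> \<gamma> \<theta> * norm w * norm v" for w v
      using A1_bounded[OF \<theta>, of w v] A1_bounded[OF \<theta>, of "- w" v]
      by (simp add: a[OF \<theta>, symmetric] blinfun.minus_left blinfun.minus_right abs_le_iff)
    have C\<^sub>O: "C\<^sub>O \<ge> 0"
      by (simp add: C\<^sub>O_def spectral_norm_nonneg)
    have u\<^sub>h_le: "norm (u\<^sub>h \<theta>) \<le> ?C\<^sub>u"
    proof -
      have "\<alpha> \<theta> * norm (u\<^sub>h \<theta>) \<le> norm (f \<theta>)"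
        using coercive[of "u\<^sub>h \<theta>"] uh[OF \<theta>] by (intro coercive_norm_le) (auto simp: a[OF \<theta>] f[OF \<theta>])
      then show ?thesis
        using \<alpha> f[OF \<theta>, abs_def] by (simp add: norm_blinfun.rep_eq field_simps)
    qed
    \<comment> \<open>Both bounds are proved for each coordinate direction separately; summation
      over \<open>j\<close> then gives the gradient norms.\<close>
    have step: "\<exists>D\<^sub>r D\<^sub>u D\<^sub>\<psi> D\<^sub>\<eta> D\<^sub>\<Delta>. has_partial_deriv \<Theta> j u\<^sub>r \<theta> D\<^sub>r \<and> has_partial_deriv \<Theta> j e\<^sub>u \<theta> D\<^sub>u \<and>
        has_partial_deriv \<Theta> j e\<^sub>\<psi> \<theta> D\<^sub>\<psi> \<and> has_partial_deriv \<Theta> j e\<^sub>\<eta> \<theta> D\<^sub>\<eta> \<and> has_partial_deriv \<Theta> j e\<^sub>\<Delta> \<theta> D\<^sub>\<Delta> \<and>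
        \<bar>D\<^sub>\<eta>\<bar> \<le> (C\<^sub>y + C\<^sub>O * ?C\<^sub>u) * norm D\<^sub>u + C\<^sub>O * norm D\<^sub>r * norm (e\<^sub>u \<theta>) \<and>
        \<bar>D\<^sub>\<Delta>\<bar> \<le> \<gamma> \<theta> * norm D\<^sub>u * norm (e\<^sub>\<psi> \<theta>) + \<gamma> \<theta> * norm D\<^sub>\<psi> * norm (e\<^sub>u \<theta>)
          + \<rho> j \<theta> * norm (e\<^sub>u \<theta>) * norm (e\<^sub>\<psi> \<theta>) + C\<^sub>O * norm (e\<^sub>u \<theta>) * norm D\<^sub>u" for j
    proof -
      note lim = slices[OF \<theta>, of j]
      obtain a' where a': "has_partial_deriv \<Theta> j a \<theta> a'"
        using A2_A \<theta> by (auto simp: continuously_differentiable_on_def partial_differentiable_def a_def[abs_def])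
      obtain f' where f': "has_partial_deriv \<Theta> j f \<theta> f'"
        using A2_F \<theta> by (auto simp: continuously_differentiable_on_def partial_differentiable_def f_def[abs_def])
      have primal: "partial_differentiable \<Theta> j u \<theta>"
        if "subspace S" "\<And>t. t \<in> \<Theta> \<Longrightarrow> u t \<in> S \<and> (\<forall>v\<in>S. A (u t) v t = F v t)" for S u
        by (rule galerkin_partial_differentiable[OF blinfun.bounded_bilinear_axioms that(1) \<theta> lim a' f' \<alpha>])
          (use that(2) in \<open>auto simp: coercive a f\<close>)
      \<comment> \<open>The derivative of the state comes first, since it makes the adjoint load
        differentiable.\<close>
      have dual: "partial_differentiable \<Theta> j \<psi> \<theta>"
        if S: "subspace S" and u: "has_partial_deriv \<Theta> j u \<theta> D"
          and \<psi>: "\<And>t. t \<in> \<Theta> \<Longrightarrow> \<psi> t \<in> S \<and> (\<forall>w\<in>S. A w (\<psi> t) t = - potential_deriv \<Gamma> obs y (u t) w)"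
        for S u D \<psi>
      proof -
        obtain l l' where l: "has_partial_deriv \<Theta> j l \<theta> l'"
          "\<And>t w. blinfun_apply (l t) w = - potential_deriv \<Gamma> obs y (u t) w"
          using partial_deriv_dual_load[OF u] by blast
        show ?thesis
          by (rule galerkin_partial_differentiable[OF bounded_bilinear_blinfun_flip S \<theta> lim a' l(1) \<alpha>])
            (use \<psi> in \<open>auto simp: coercive a l(2)\<close>)
      qed
      obtain D\<^sub>h where D\<^sub>h: "has_partial_deriv \<Theta> j u\<^sub>h \<theta> D\<^sub>h"
        using primal[OF Vh(1) uh] by (auto simp: partial_differentiable_def)
      obtain D\<^sub>r where D\<^sub>r: "has_partial_deriv \<Theta> j u\<^sub>r \<theta> D\<^sub>r"
        using primal[OF Vr(1) ur] by (auto simp: partial_differentiable_def)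
      obtain P\<^sub>h where P\<^sub>h: "has_partial_deriv \<Theta> j \<psi>\<^sub>h \<theta> P\<^sub>h"
        using dual[OF Vh(1) D\<^sub>h \<psi>h] by (auto simp: partial_differentiable_def)
      obtain P\<^sub>r where P\<^sub>r: "has_partial_deriv \<Theta> j \<psi>\<^sub>r \<theta> P\<^sub>r"
        using dual[OF Wr(1) D\<^sub>r \<psi>r] by (auto simp: partial_differentiable_def)
      define D\<^sub>u where "D\<^sub>u = D\<^sub>h - D\<^sub>r"
      define D\<^sub>\<psi> where "D\<^sub>\<psi> = P\<^sub>h - P\<^sub>r"
      define D\<^sub>\<eta> where
        "D\<^sub>\<eta> = potential_deriv \<Gamma> obs y (u\<^sub>h \<theta>) D\<^sub>h - potential_deriv \<Gamma> obs y (u\<^sub>r \<theta>) D\<^sub>r"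
      \<comment> \<open>The product rule for evaluation is applied twice, first to
        \<open>a t (e\<^sub>u t)\<close> and then to its value at \<open>e\<^sub>\<psi> t\<close>;
        \<open>a'\<close> carries the explicit parameter dependence of the form.\<close>
      define D\<^sub>\<Delta> where "D\<^sub>\<Delta> = - (a \<theta> (e\<^sub>u \<theta>) D\<^sub>\<psi> + (a \<theta> D\<^sub>u + a' (e\<^sub>u \<theta>)) (e\<^sub>\<psi> \<theta>))
        - potential_deriv \<Gamma> obs 0 (e\<^sub>u \<theta>) D\<^sub>u"
      have e\<^sub>u': "has_partial_deriv \<Theta> j e\<^sub>u \<theta> D\<^sub>u"
        unfolding e\<^sub>u_def[abs_def] D\<^sub>u_def by (rule has_partial_deriv_diff[OF D\<^sub>h D\<^sub>r])
      have e\<^sub>\<psi>': "has_partial_deriv \<Theta> j e\<^sub>\<psi> \<theta> D\<^sub>\<psi>"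
        unfolding e\<^sub>\<psi>_def[abs_def] D\<^sub>\<psi>_def by (rule has_partial_deriv_diff[OF P\<^sub>h P\<^sub>r])
      have e\<^sub>\<eta>': "has_partial_deriv \<Theta> j e\<^sub>\<eta> \<theta> D\<^sub>\<eta>"
        unfolding e\<^sub>\<eta>_def[abs_def] D\<^sub>\<eta>_def
        by (intro has_partial_deriv_diff potential_partial_deriv \<Gamma>_spd D\<^sub>h D\<^sub>r)
      have "has_partial_deriv \<Theta> j (\<lambda>t. - a t (e\<^sub>u t) (e\<^sub>\<psi> t) - potential \<Gamma> obs 0 (e\<^sub>u t)) \<theta> D\<^sub>\<Delta>"
        unfolding D\<^sub>\<Delta>_def
        by (intro has_partial_deriv_diff potential_partial_deriv \<Gamma>_spd e\<^sub>u' e\<^sub>\<psi>' a'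
            bounded_linear.has_partial_deriv[OF bounded_linear_minus[OF bounded_linear_ident]]
            blinfun.has_partial_deriv)
      then have e\<^sub>\<Delta>': "has_partial_deriv \<Theta> j e\<^sub>\<Delta> \<theta> D\<^sub>\<Delta>"
        using \<theta> e\<^sub>\<Delta>_eq by (rule has_partial_deriv_transform)
      \<comment> \<open>Evaluation at fixed \<open>w\<close> and \<open>v\<close> is bounded linear,
        so \<open>a' w v\<close> is the partial derivative of \<open>A w v\<close>, and the constant
        \<open>\<rho> j \<theta>\<close> of (A2) applies.\<close>
      have a'_le: "a' w v \<le> \<rho> j \<theta> * norm w * norm v" for w v
      proof -
        have "bounded_linear (\<lambda>M :: 'v \<Rightarrow>\<^sub>L 'v \<Rightarrow>\<^sub>L real. M w v)"
          by (intro bounded_linear_compose[OF blinfun.bounded_linear_left blinfun.bounded_linear_left])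
        then have "has_partial_deriv \<Theta> j (\<lambda>t. a t w v) \<theta> (a' w v)"
          using a' by (rule bounded_linear.has_partial_deriv)
        then have "has_partial_deriv \<Theta> j (A w v) \<theta> (a' w v)"
          using \<theta> by (rule has_partial_deriv_transform) (simp add: a)
        then show ?thesis
          using A2_dA[OF \<theta>, of j w v] by (simp add: partial_deriv_eq[OF lim])
      qed
      have a'_abs: "\<bar>a' w v\<bar> \<le> \<rho> j \<theta> * norm w * norm v" for w v
        using a'_le[of w v] a'_le[of "- w" v]
        by (simp add: blinfun.minus_left blinfun.minus_right abs_le_iff)
      have "D\<^sub>\<eta> = potential_deriv \<Gamma> obs y (u\<^sub>h \<theta>) D\<^sub>u + observe obs (e\<^sub>u \<theta>) \<bullet> (?M *v observe obs D\<^sub>r)"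
        using potential_deriv_diff[of \<Gamma> obs y "u\<^sub>h \<theta>" D\<^sub>r "u\<^sub>r \<theta>"]
        by (simp add: D\<^sub>\<eta>_def D\<^sub>u_def e\<^sub>u_def potential_deriv_diff_right[OF \<Gamma>_spd])
      moreover have "\<bar>potential_deriv \<Gamma> obs y (u\<^sub>h \<theta>) D\<^sub>u\<bar> \<le> (C\<^sub>y + C\<^sub>O * ?C\<^sub>u) * norm D\<^sub>u"
      proof -
        have "\<bar>potential_deriv \<Gamma> obs y (u\<^sub>h \<theta>) D\<^sub>u\<bar> \<le> (C\<^sub>y + C\<^sub>O * norm (u\<^sub>h \<theta>)) * norm D\<^sub>u"
          unfolding C\<^sub>y_def C\<^sub>O_def by (rule abs_potential_deriv_le)
        also have "\<dots> \<le> (C\<^sub>y + C\<^sub>O * ?C\<^sub>u) * norm D\<^sub>u"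
          by (intro mult_right_mono add_left_mono mult_left_mono u\<^sub>h_le C\<^sub>O) simp
        finally show ?thesis .
      qed
      moreover have "\<bar>observe obs (e\<^sub>u \<theta>) \<bullet> (?M *v observe obs D\<^sub>r)\<bar> \<le> C\<^sub>O * norm D\<^sub>r * norm (e\<^sub>u \<theta>)"
        using abs_observe_inner_le[of obs "e\<^sub>u \<theta>" ?M D\<^sub>r] by (simp add: C\<^sub>O_def mult_ac)
      ultimately have 1: "\<bar>D\<^sub>\<eta>\<bar> \<le> (C\<^sub>y + C\<^sub>O * ?C\<^sub>u) * norm D\<^sub>u + C\<^sub>O * norm D\<^sub>r * norm (e\<^sub>u \<theta>)"
        by linarith
      have "\<bar>potential_deriv \<Gamma> obs 0 (e\<^sub>u \<theta>) D\<^sub>u\<bar> \<le> C\<^sub>O * norm (e\<^sub>u \<theta>) * norm D\<^sub>u"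
        using abs_potential_deriv_le[of \<Gamma> obs 0 "e\<^sub>u \<theta>" D\<^sub>u] by (simp add: C\<^sub>O_def)
      then have 2: "\<bar>D\<^sub>\<Delta>\<bar> \<le> \<gamma> \<theta> * norm D\<^sub>u * norm (e\<^sub>\<psi> \<theta>) + \<gamma> \<theta> * norm D\<^sub>\<psi> * norm (e\<^sub>u \<theta>)
          + \<rho> j \<theta> * norm (e\<^sub>u \<theta>) * norm (e\<^sub>\<psi> \<theta>) + C\<^sub>O * norm (e\<^sub>u \<theta>) * norm D\<^sub>u"
        using a_abs[of D\<^sub>u "e\<^sub>\<psi> \<theta>"] a_abs[of "e\<^sub>u \<theta>" D\<^sub>\<psi>] a'_abs[of "e\<^sub>u \<theta>" "e\<^sub>\<psi> \<theta>"]
        by (simp add: D\<^sub>\<Delta>_def blinfun.add_left mult_ac)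
      show ?thesis
        by (intro exI conjI) (rule D\<^sub>r e\<^sub>u' e\<^sub>\<psi>' e\<^sub>\<eta>' e\<^sub>\<Delta>' 1 2)+
    qed
    have bounds: "\<bar>partial_deriv \<Theta> j e\<^sub>\<eta> \<theta>\<bar>
          \<le> (C\<^sub>y + C\<^sub>O * ?C\<^sub>u) * norm (partial_deriv \<Theta> j e\<^sub>u \<theta>)
            + C\<^sub>O * norm (partial_deriv \<Theta> j u\<^sub>r \<theta>) * norm (e\<^sub>u \<theta>)"
        "\<bar>partial_deriv \<Theta> j e\<^sub>\<Delta> \<theta>\<bar>
          \<le> \<gamma> \<theta> * norm (partial_deriv \<Theta> j e\<^sub>u \<theta>) * norm (e\<^sub>\<psi> \<theta>)
            + \<gamma> \<theta> * norm (partial_deriv \<Theta> j e\<^sub>\<psi> \<theta>) * norm (e\<^sub>u \<theta>)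
            + \<rho> j \<theta> * norm (e\<^sub>u \<theta>) * norm (e\<^sub>\<psi> \<theta>)
            + C\<^sub>O * norm (e\<^sub>u \<theta>) * norm (partial_deriv \<Theta> j e\<^sub>u \<theta>)" for j
      \<comment> \<open>As 0 is a limit point of each slice, derivatives are unique and the
        witnesses of \<open>step\<close> are the values of \<open>partial_deriv\<close>.\<close>
      using step[of j] by (auto simp: partial_deriv_eq[OF slices[OF \<theta>]])
    have "grad_norm \<Theta> e\<^sub>\<eta> \<theta> \<le>
         (C\<^sub>y + C\<^sub>O * ?C\<^sub>u) * grad_norm \<Theta> e\<^sub>u \<theta> + C\<^sub>O * grad_norm \<Theta> u\<^sub>r \<theta> * norm (e\<^sub>u \<theta>)"
      using sum_mono[of UNIV, OF bounds(1)]
      by (simp only: grad_norm_def sum.distrib sum_distrib_left sum_distrib_right real_norm_def)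
    moreover have "grad_norm \<Theta> e\<^sub>\<Delta> \<theta> \<le>
         \<gamma> \<theta> * grad_norm \<Theta> e\<^sub>u \<theta> * norm (e\<^sub>\<psi> \<theta>) + \<gamma> \<theta> * grad_norm \<Theta> e\<^sub>\<psi> \<theta> * norm (e\<^sub>u \<theta>)
         + (\<Sum>j\<in>UNIV. \<rho> j \<theta> * norm (e\<^sub>u \<theta>) * norm (e\<^sub>\<psi> \<theta>))
         + C\<^sub>O * norm (e\<^sub>u \<theta>) * grad_norm \<Theta> e\<^sub>u \<theta>"
      using sum_mono[of UNIV, OF bounds(2)]
      by (simp only: grad_norm_def sum.distrib sum_distrib_left sum_distrib_right real_norm_def)
    moreover have "partial_differentiable \<Theta> j u\<^sub>r \<theta> \<and> partial_differentiable \<Theta> j e\<^sub>u \<theta> \<and>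
            partial_differentiable \<Theta> j e\<^sub>\<psi> \<theta> \<and> partial_differentiable \<Theta> j e\<^sub>\<eta> \<theta> \<and>
            partial_differentiable \<Theta> j e\<^sub>\<Delta> \<theta>" for j
      using step[of j] by (auto simp: partial_differentiable_def)
    ultimately show ?thesis
      by simp
  qed
  show ?thesis
    unfolding Let_def
    by (intro ballI main[unfolded C\<^sub>y_def C\<^sub>O_def e\<^sub>u_def[abs_def] e\<^sub>\<psi>_def[abs_def]
          e\<^sub>\<eta>_def[abs_def] e\<^sub>\<Delta>_def[abs_def]])
qed

end
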